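(* Let $I=\{1,\dots,n\}$, let $t_i$ ($i\in I$) be distinct nonzero complex numbers, and let $a_i\in\mathbb Z$ with $a_i\ge-2$ for $i\in I$. For an integer $t\ge-2$ set $I(t)=\{i\in I: a_i=t\}$. Then, as formal series in $z,z^{-1}$, $$\prod_{i\in I}(1-t_iz)^{a_i}-\prod_{i\in I}(1-t_i^{-1}z^{-1})^{a_i}(-t_iz)^{a_i}=\sum_{i\in I(-1)}\ \prod_{j\in I,\,j\ne i}(1-t_jt_i^{-1})^{a_j}\,\delta(t_iz)$$ $$+\sum_{i\in I(-2)}\ \prod_{j\in I,\,j\ne i}(1-t_jt_i^{-1})^{a_j}\Bigl[(D\delta)(t_iz)+\Bigl(1+\sum_{j\in I,\,j\ne i}a_j(t_it_j^{-1}-1)^{-1}\Bigr)\delta(t_iz)\Bigr].$$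
   Context: $z$ is a formal variable; $\delta(z)=\sum_{n\in\mathbb Z}z^n$ and $(D\delta)(z)=\sum_{n\in\mathbb Z}nz^n$. Negative powers of $1-t_iz$ are expanded in nonnegative powers of $z$, and negative powers of $1-t_i^{-1}z^{-1}$ in nonnegative powers of $z^{-1}$. *)

theory Defs
  imports Complex_Main "HOL-Computational_Algebra.Formal_Laurent_Series"
begin

text \<open>
  Formal series in \<open>z\<close> and \<open>z\<^sup>-\<^sup>1\<close>, infinite in both directions: \<open>f\<close> stands for the series
  whose coefficient at \<open>z\<^sup>n\<close> is \<open>f n\<close>. Such series have no product; only the linear operations
  below are used on them.
\<close>

type_synonym bi_series = "int \<Rightarrow> complex"

definition series_of_z :: "complex fls \<Rightarrow> bi_series" where
  "series_of_z F = (\<lambda>n. fls_nth F n)"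

text \<open>Here the variable \<open>fls_X\<close> of the Laurent series plays the role of \<open>z\<^sup>-\<^sup>1\<close>, and so
  \<open>fls_X_inv\<close> that of \<open>z\<close>.\<close>

definition series_of_z_inv :: "complex fls \<Rightarrow> bi_series" where
  "series_of_z_inv F = (\<lambda>n. fls_nth F (- n))"

definition delta :: bi_series where
  "delta = (\<lambda>n. 1)"

text \<open>The Euler operator \<open>z d/dz\<close>.\<close>

definition D :: "bi_series \<Rightarrow> bi_series" where
  "D f = (\<lambda>n. of_int n * f n)"

text \<open>The substitution \<open>f(c z)\<close>, meaningful for nonzero \<open>c\<close>.\<close>

definition rescale :: "bi_series \<Rightarrow> complex \<Rightarrow> bi_series" where
  "rescale f c = (\<lambda>n. c powi n * f n)"

definition level_set :: "nat \<Rightarrow> (nat \<Rightarrow> int) \<Rightarrow> int \<Rightarrow> nat set" where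
  "level_set n a s = {i \<in> {1..n}. a i = s}"

end

theory Submission
  imports Defs
begin

text \<open>
  For each exponent vector \<open>a\<close> let \<open>E(a)\<close> be the left-hand side minus the right-hand side.
  Both sides are compatible with raising one exponent: multiplying \<open>E(a)\<close> by \<open>1 - t\<^sub>j z\<close>
  gives \<open>E(a')\<close>, where \<open>a'\<close> is \<open>a\<close> with \<open>a\<^sub>j\<close> increased by one; on the right-hand side this
  holds for every summand separately. Hence positive exponents reduce to zero exponents. If two
  exponents are negative, then by induction \<open>E(a)\<close> is annihilated by two coprime linear factors
  and vanishes. If only \<open>a\<^sub>i\<close> is negative, then \<open>E(a)\<close> is annihilated by \<open>1 - t\<^sub>i z\<close>, so it is a
  multiple of \<open>\<delta>(t\<^sub>i z)\<close>, and it vanishes because one of its coefficients does.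
\<close>

text \<open>Both products expand one rational function, at zero and at infinity. In the second,
  \<open>fls_X_inv\<close> stands for \<open>z\<close>, and
  \<open>(1 - t_i^-1 z^-1) (-t_i z)\<close> is already merged into \<open>1 - t_i z\<close>.\<close>

definition expansion_gap :: "'i set \<Rightarrow> ('i \<Rightarrow> complex) \<Rightarrow> ('i \<Rightarrow> int) \<Rightarrow> bi_series" where
  "expansion_gap I t a = (\<lambda>k.
     series_of_z (\<Prod>i\<in>I. (1 - fls_const (t i) * fls_X) powi a i) k
     - series_of_z_inv (\<Prod>i\<in>I. (1 - fls_const (t i) * fls_X_inv) powi a i) k)"

definition pole_coeff :: "'i set \<Rightarrow> ('i \<Rightarrow> complex) \<Rightarrow> ('i \<Rightarrow> int) \<Rightarrow> 'i \<Rightarrow> complex" where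
  "pole_coeff I t a i = (\<Prod>j\<in>I - {i}. (1 - t j * inverse (t i)) powi a j)"

definition pole_shift :: "'i set \<Rightarrow> ('i \<Rightarrow> complex) \<Rightarrow> ('i \<Rightarrow> int) \<Rightarrow> 'i \<Rightarrow> complex" where
  "pole_shift I t a i = 1 + (\<Sum>j\<in>I - {i}. of_int (a j) * inverse (t i * inverse (t j) - 1))"

text \<open>The zero branch lets the sums over the two level sets become a single sum over
  \<open>I\<close>; \<open>t_i^k\<close> and \<open>k t_i^k\<close> are the coefficients of
  \<open>delta(t_i z)\<close> and \<open>(D delta)(t_i z)\<close>.\<close>

definition pole_term :: "'i set \<Rightarrow> ('i \<Rightarrow> complex) \<Rightarrow> ('i \<Rightarrow> int) \<Rightarrow> 'i \<Rightarrow> bi_series" where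
  "pole_term I t a i = (\<lambda>k.
     if a i = -1 then pole_coeff I t a i * t i powi k
     else if a i = -2 then pole_coeff I t a i * (of_int k + pole_shift I t a i) * t i powi k
     else 0)"

definition gap_error :: "'i set \<Rightarrow> ('i \<Rightarrow> complex) \<Rightarrow> ('i \<Rightarrow> int) \<Rightarrow> bi_series" where
  "gap_error I t a = (\<lambda>k. expansion_gap I t a k - (\<Sum>i\<in>I. pole_term I t a i k))"

text \<open>The product with \<open>1 - c z\<close>, which makes sense for every two-sided series
  because the factor is a polynomial.\<close>

definition mult_linear :: "complex \<Rightarrow> bi_series \<Rightarrow> bi_series" where
  "mult_linear c h = (\<lambda>k. h k - c * h (k - 1))"

section \<open>Linear factors acting on the two expansions\<close>

lemma one_minus_const_X_neq_0: "1 - fls_const (c::complex) * fls_X \<noteq> 0"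
proof
  assume "1 - fls_const c * fls_X = 0"
  then have "fls_nth (1 - fls_const c * fls_X) 0 = 0" by simp
  then show False by (simp add: fls_X_def)
qed

lemma one_minus_const_X_inv_neq_0: "1 - fls_const (c::complex) * fls_X_inv \<noteq> 0"
proof
  assume "1 - fls_const c * fls_X_inv = 0"
  then have "fls_nth (1 - fls_const c * fls_X_inv) 0 = 0" by simp
  then show False by simp
qed

lemma series_of_z_mult_linear:
  "series_of_z ((1 - fls_const c * fls_X) * F) = mult_linear c (series_of_z F)"
proof -
  have "(1 - fls_const c * fls_X) * F = F - fls_const c * (fls_X * F)"
    by (simp add: algebra_simps)
  then show ?thesis
    by (simp add: series_of_z_def mult_linear_def fls_X_times_conv_shift)
qed

lemma series_of_z_inv_mult_linear:
  "series_of_z_inv ((1 - fls_const c * fls_X_inv) * F) = mult_linear c (series_of_z_inv F)"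
proof -
  have "(1 - fls_const c * fls_X_inv) * F = F - fls_const c * (fls_X_inv * F)"
    by (simp add: algebra_simps)
  then show ?thesis
    by (simp add: series_of_z_inv_def mult_linear_def fls_X_inv_times_conv_shift add.commute
        flip: diff_conv_add_uminus)
qed

section \<open>Raising one exponent\<close>

lemma prod_powi_increment:
  fixes f :: "'i \<Rightarrow> 'b :: field"
  assumes "finite I" "j \<in> I" "f j \<noteq> 0"
  shows "(\<Prod>i\<in>I. f i powi (a(j := a j + 1)) i) = f j * (\<Prod>i\<in>I. f i powi a i)"
proof -
  have "(\<Prod>i\<in>I - {j}. f i powi (a(j := a j + 1)) i) = (\<Prod>i\<in>I - {j}. f i powi a i)"
    by (rule prod.cong) auto
  \<comment> \<open>The hypothesis \<open>f j \<noteq> 0\<close> matters at \<open>a j = -1\<close>: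
    \<open>0 powi 0\<close> is 1, but \<open>0 * 0 powi (-1)\<close> is 0.\<close>
  then show ?thesis
    using assms by (simp add: prod.remove[OF assms(1,2)] power_int_add_1 mult_ac)
qed

lemma expansion_gap_increment:
  assumes "finite I" "j \<in> I"
  shows "expansion_gap I t (a(j := a j + 1)) = mult_linear (t j) (expansion_gap I t a)"
  unfolding expansion_gap_def
    prod_powi_increment[OF assms one_minus_const_X_neq_0]
    prod_powi_increment[OF assms one_minus_const_X_inv_neq_0]
    series_of_z_mult_linear series_of_z_inv_mult_linear
  by (simp add: mult_linear_def algebra_simps)

text \<open>On \<open>delta(t_i z)\<close> the factor \<open>1 - t_j z\<close> acts as its value at
  \<open>z = 1 / t_i\<close>: zero for \<open>i = j\<close>, otherwise the new factor of
  \<open>pole_coeff\<close>. On \<open>(D delta)(t_i z)\<close> it leaves a further multiple of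
  \<open>delta(t_i z)\<close>, which is the whole result for \<open>i = j\<close> and otherwise
  matches the increment of \<open>pole_shift\<close>. The bound on \<open>a j\<close> excludes the
  step from -3 to -2, where a pole term would arise from zero.\<close>

lemma pole_term_increment:
  assumes "finite I" "inj_on t I" "\<And>i. i \<in> I \<Longrightarrow> t i \<noteq> 0"
    and "j \<in> I" "a j \<ge> -2" "i \<in> I"
  shows "pole_term I t (a(j := a j + 1)) i = mult_linear (t j) (pole_term I t a i)"
proof (cases "i = j")
  case True
  have "pole_coeff I t (a(j := a j + 1)) i = pole_coeff I t a i"
    unfolding pole_coeff_def using True by (intro prod.cong) auto
  moreover have "pole_shift I t (a(j := a j + 1)) i = pole_shift I t a i"
    unfolding pole_shift_def using True by (intro arg_cong2[of _ _ _ _ "(+)"] sum.cong) auto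
  moreover have "t j \<noteq> 0" using assms by auto
  ultimately show ?thesis
    using True assms(5)
    by (auto simp: pole_term_def mult_linear_def fun_eq_iff power_int_diff field_simps)
next
  case False
  define r where "r = t j * inverse (t i)"
  have ti: "t i \<noteq> 0" and tj: "t j \<noteq> 0" using assms by auto
  have "t i \<noteq> t j" using False assms by (auto dest: inj_onD)
  then have r1: "1 - r \<noteq> 0" using ti by (auto simp: r_def field_simps)
  have jI: "finite (I - {i})" "j \<in> I - {i}" using assms False by auto
  have c: "pole_coeff I t (a(j := a j + 1)) i = (1 - r) * pole_coeff I t a i"
    unfolding pole_coeff_def r_def
    by (rule prod_powi_increment[OF jI]) (use r1 r_def in auto)
  have "(\<Sum>l\<in>I - {i} - {j}. of_int ((a(j := a j + 1)) l) * inverse (t i * inverse (t l) - 1))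
      = (\<Sum>l\<in>I - {i} - {j}. of_int (a l) * inverse (t i * inverse (t l) - 1))"
    by (intro sum.cong) auto
  then have s: "pole_shift I t (a(j := a j + 1)) i
      = pole_shift I t a i + inverse (t i * inverse (t j) - 1)"
    unfolding pole_shift_def by (simp add: sum.remove[OF jI] algebra_simps)
  \<comment> \<open>The further multiple of \<open>delta(t_i z)\<close> is \<open>r\<close>, the
    value of \<open>t_j z\<close> at \<open>z = 1 / t_i\<close>.\<close>
  have inv: "(1 - r) * inverse (t i * inverse (t j) - 1) = r"
    using ti tj \<open>t i \<noteq> t j\<close> by (simp add: r_def field_simps)
  have pw: "t j * t i powi (k - 1) = r * t i powi k" for k
    using ti by (simp add: r_def power_int_diff field_simps)
  have "mult_linear (t j) (pole_term I t a i) k = pole_term I t (a(j := a j + 1)) i k" for k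
  proof -
    have 1: "C * t i powi k - t j * (C * t i powi (k - 1)) = (1 - r) * C * t i powi k" for C
      using pw[of k] by (simp add: algebra_simps)
    have 2: "C * (of_int k + L) * t i powi k
          - t j * (C * (of_int (k - 1) + L) * t i powi (k - 1))
        = (1 - r) * C * (of_int k + (L + inverse (t i * inverse (t j) - 1))) * t i powi k" for C L
    proof -
      have "t j * (C * (of_int (k - 1) + L) * t i powi (k - 1))
          = C * (of_int (k - 1) + L) * (t j * t i powi (k - 1))" by (simp only: mult_ac)
      also have "\<dots> = C * (of_int (k - 1) + L) * (r * t i powi k)" by (simp only: pw)
      finally have A: "t j * (C * (of_int (k - 1) + L) * t i powi (k - 1))
          = C * (of_int (k - 1) + L) * (r * t i powi k)" .
      have "(1 - r) * C * (of_int k + (L + inverse (t i * inverse (t j) - 1))) * t i powi k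
          = C * t i powi k * ((1 - r) * (of_int k + L)
              + (1 - r) * inverse (t i * inverse (t j) - 1))"
        by (simp only: algebra_simps)
      then show ?thesis unfolding A inv by (simp add: algebra_simps)
    qed
    show ?thesis
      using False 1 2 by (simp add: mult_linear_def pole_term_def c s)
  qed
  then show ?thesis by (rule ext[symmetric])
qed

lemma gap_error_increment:
  assumes "finite I" "inj_on t I" "\<And>i. i \<in> I \<Longrightarrow> t i \<noteq> 0" "j \<in> I" "a j \<ge> -2"
  shows "gap_error I t (a(j := a j + 1)) = mult_linear (t j) (gap_error I t a)"
proof -
  have "(\<Sum>i\<in>I. pole_term I t (a(j := a j + 1)) i k)
      = (\<Sum>i\<in>I. mult_linear (t j) (pole_term I t a i) k)" for k
    by (intro sum.cong refl) (simp add: pole_term_increment assms)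
  then show ?thesis
    unfolding gap_error_def expansion_gap_increment[OF assms(1,4)]
    by (simp add: mult_linear_def fun_eq_iff sum_subtractf sum_distrib_left algebra_simps)
qed

section \<open>Series annihilated by linear factors\<close>

text \<open>\<open>1 - c z\<close> and \<open>1 - d z\<close> generate the unit ideal when \<open>c \<noteq> d\<close>.\<close>

lemma mult_linear_coprime:
  assumes "mult_linear c h = (\<lambda>_. 0)" "mult_linear d h = (\<lambda>_. 0)" "c \<noteq> d"
  shows "h = (\<lambda>_. 0)"
proof
  fix k
  have "h k = c * h (k - 1)" "h k = d * h (k - 1)"
    using fun_cong[OF assms(1), of k] fun_cong[OF assms(2), of k] by (auto simp: mult_linear_def)
  then show "h k = 0" using assms(3) by (metis mult_cancel_right mult_zero_right)
qed

text \<open>The recurrence \<open>h l = c * h (l - 1)\<close> carries one zero upwards, and also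
  downwards since \<open>c \<noteq> 0\<close>.\<close>

lemma mult_linear_eq_0_cancel:
  assumes "mult_linear c h = (\<lambda>_. 0)" "c \<noteq> 0" "h m = 0"
  shows "h = (\<lambda>_. 0)"
proof
  fix k
  have st: "h l = c * h (l - 1)" for l
    using fun_cong[OF assms(1), of l] by (simp add: mult_linear_def)
  show "h k = 0"
  proof (induction k rule: int_induct[where k = m])
    case (step1 i)
    then show ?case using st[of "i + 1"] by simp
  next
    case (step2 i)
    then show ?case using st[of i] assms(2) by simp
  qed (rule assms(3))
qed

section \<open>Exponents between -2 and 0\<close>

lemma fls_subdegree_one_minus_const_X: "fls_subdegree (1 - fls_const (c::complex) * fls_X) = 0"
  by (rule fls_subdegree_eqI) (auto simp: fls_X_times_conv_shift)

lemma fls_subdegree_one_minus_const_X_inv: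
  "c \<noteq> 0 \<Longrightarrow> fls_subdegree (1 - fls_const (c::complex) * fls_X_inv) = -1"
  by (rule fls_subdegree_eqI) auto

text \<open>For exponent -1 the coefficient at \<open>z^0\<close> serves: the expansion at zero and
  the delta term both give 1, the expansion at infinity gives 0. For exponent -2 it is the one at
  \<open>z^-1\<close>, where all three vanish.\<close>

lemma gap_error_single_pole:
  assumes "finite I" "i \<in> I" "t i \<noteq> 0" "a i = -1 \<or> a i = -2"
    and zero: "\<And>j. j \<in> I - {i} \<Longrightarrow> a j = 0"
  obtains m where "gap_error I t a m = 0"
proof -
  define F where "F = (1 - fls_const (t i) * fls_X) powi a i"
  define G where "G = (1 - fls_const (t i) * fls_X_inv) powi a i"
  have gap: "expansion_gap I t a k = fls_nth F k - fls_nth G (-k)" for k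
    unfolding expansion_gap_def F_def G_def
    by (simp add: prod.remove[OF assms(1,2)] zero series_of_z_def series_of_z_inv_def)
  have "pole_term I t a j k = 0" if "j \<in> I - {i}" for j k
    using zero[OF that] by (simp add: pole_term_def)
  then have err: "gap_error I t a k = fls_nth F k - fls_nth G (-k) - pole_term I t a i k" for k
    by (simp add: gap_error_def gap sum.remove[OF assms(1,2)])
  have coeff: "pole_coeff I t a i = 1" and shift: "pole_shift I t a i = 1"
    by (simp_all add: pole_coeff_def pole_shift_def zero)
  have "fls_subdegree F = 0"
    by (simp add: F_def fls_subdegree_one_minus_const_X)
  then have F_neg: "fls_nth F (-1) = 0" by simp
  \<comment> \<open>In \<open>G\<close> the variable is \<open>z^-1\<close>, so its highest power of
    \<open>z\<close> is \<open>z^(a i)\<close>, below the coefficient inspected in either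
    case.\<close>
  have subG: "fls_subdegree G = - a i"
    using assms(3) by (simp add: G_def fls_subdegree_one_minus_const_X_inv)
  from assms(4) show ?thesis
  proof
    assume ai: "a i = -1"
    have "(1 - fls_const (t i) * fls_X) * F = 1"
      using one_minus_const_X_neq_0[of "t i"] by (simp add: F_def ai power_int_minus)
    then have "series_of_z 1 0 = mult_linear (t i) (series_of_z F) 0"
      by (simp flip: series_of_z_mult_linear)
    then have "fls_nth F 0 = 1"
      using F_neg by (simp add: series_of_z_def mult_linear_def)
    moreover have "fls_nth G 0 = 0" using subG ai by simp
    ultimately have "gap_error I t a 0 = 0"
      by (simp add: err pole_term_def coeff ai)
    then show ?thesis by (rule that)
  next
    assume ai: "a i = -2"
    have "fls_nth G 1 = 0" using subG ai by simp
    \<comment> \<open>The shift is 1, so the factor \<open>k + 1\<close> of the pole term vanishes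
      at \<open>k = -1\<close>.\<close>
    then have "gap_error I t a (-1) = 0"
      using F_neg by (simp add: err pole_term_def coeff shift ai)
    then show ?thesis by (rule that)
  qed
qed

lemma gap_error_nonpos:
  assumes "finite I" "inj_on t I" "\<And>i. i \<in> I \<Longrightarrow> t i \<noteq> 0"
    and "\<And>i. i \<in> I \<Longrightarrow> -2 \<le> a i \<and> a i \<le> 0"
  shows "gap_error I t a = (\<lambda>_. 0)"
  using assms(4)
\<comment> \<open>Raising a negative exponent lowers this measure by one and keeps all exponents
  between -2 and 0.\<close>
proof (induction "nat (- (\<Sum>i\<in>I. a i))" arbitrary: a rule: less_induct)
  case less
  have IH: "mult_linear (t j) (gap_error I t a) = (\<lambda>_. 0)" if j: "j \<in> I" "a j < 0" for j
  proof -
    let ?b = "a(j := a j + 1)"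
    have "sum ?b (I - {j}) = sum a (I - {j})" by (rule sum.cong) auto
    then have "sum ?b I = sum a I + 1"
      by (simp add: sum.remove[OF assms(1) j(1)])
    moreover have b: "-2 \<le> ?b i \<and> ?b i \<le> 0" if "i \<in> I" for i
      using less.prems[OF that] j by auto
    moreover have "sum ?b I \<le> 0" using b by (intro sum_nonpos) auto
    ultimately have "gap_error I t ?b = (\<lambda>_. 0)" by (intro less.hyps) auto
    moreover have "-2 \<le> a j" using less.prems j by blast
    ultimately show ?thesis
      using gap_error_increment[OF assms(1-3) j(1)] by simp
  qed
  consider (none) "\<forall>i\<in>I. a i = 0"
    | (one) i where "i \<in> I" "a i < 0" "\<forall>j\<in>I - {i}. a j = 0"
    | (two) i j where "i \<in> I" "a i < 0" "j \<in> I" "a j < 0" "i \<noteq> j"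
    using less.prems by (metis DiffD1 DiffD2 insertI1 order_le_less)
  then show ?case
  proof cases
    case none
    then show ?thesis
      by (auto simp: gap_error_def expansion_gap_def pole_term_def series_of_z_def
          series_of_z_inv_def fun_eq_iff)
  next
    case one
    have "a i = -1 \<or> a i = -2" using one less.prems[of i] by auto
    then obtain m where "gap_error I t a m = 0"
      using gap_error_single_pole[of I i t a] one assms by metis
    then show ?thesis
      using mult_linear_eq_0_cancel[OF IH] one assms(3) by blast
  next
    case two
    then have "t i \<noteq> t j" using assms(2) by (auto dest: inj_onD)
    then show ?thesis using mult_linear_coprime[OF IH IH] two by blast
  qed
qed

section \<open>Arbitrary exponents and the stated form\<close>

lemma gap_error_eq_0:
  assumes "finite I" "inj_on t I" "\<And>i. i \<in> I \<Longrightarrow> t i \<noteq> 0" "\<And>i. i \<in> I \<Longrightarrow> -2 \<le> a i"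
  shows "gap_error I t a = (\<lambda>_. 0)"
  using assms(4)
\<comment> \<open>Since \<open>nat\<close> truncates at zero, only positive exponents count in the
  measure.\<close>
proof (induction "\<Sum>i\<in>I. nat (a i)" arbitrary: a rule: less_induct)
  case less
  show ?case
  proof (cases "\<exists>j\<in>I. a j > 0")
    case False
    then show ?thesis using less.prems by (intro gap_error_nonpos[OF assms(1-3)]) force+
  next
    case True
    then obtain j where j: "j \<in> I" "a j > 0" by blast
    let ?b = "a(j := a j - 1)"
    have "(\<Sum>i\<in>I - {j}. nat (?b i)) = (\<Sum>i\<in>I - {j}. nat (a i))" by (rule sum.cong) auto
    then have "(\<Sum>i\<in>I. nat (?b i)) < (\<Sum>i\<in>I. nat (a i))"
      using j by (simp add: sum.remove[OF assms(1) j(1)])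
    moreover have "-2 \<le> ?b i" if "i \<in> I" for i using less.prems[OF that] j by auto
    ultimately have "gap_error I t ?b = (\<lambda>_. 0)" by (intro less.hyps) auto
    then show ?thesis
      \<comment> \<open>Raising the exponent of \<open>?b\<close> at \<open>j\<close> gives back
        \<open>a\<close>, so its error is \<open>1 - t_j z\<close> times zero; nothing has to be
        cancelled.\<close>
      using gap_error_increment[OF assms(1-3) j(1), of ?b] j
      by (simp add: mult_linear_def)
  qed
qed

text \<open>With \<open>fls_X\<close> as \<open>z^-1\<close>, this merges the two powers in the
  second product of the theorem into one power of \<open>1 - t_i z\<close>.\<close>

lemma one_minus_const_X_inv_factor:
  assumes "(c::complex) \<noteq> 0"
  shows "(1 - fls_const (inverse c) * fls_X) * (- fls_const c * fls_X_inv)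
    = 1 - fls_const c * fls_X_inv"
proof -
  have "fls_const (inverse c) * fls_X * (fls_const c * fls_X_inv)
      = (fls_const (inverse c) * fls_const c) * (fls_X * fls_X_inv)" by (simp only: mult_ac)
  also have "\<dots> = 1" using assms by (simp add: fls_X_times_conv_shift)
  finally show ?thesis by (simp add: algebra_simps)
qed

theorem proposition4p3:
  fixes n :: nat and t :: "nat \<Rightarrow> complex" and a :: "nat \<Rightarrow> int"
  assumes "inj_on t {1..n}"
    and "\<And>i. i \<in> {1..n} \<Longrightarrow> t i \<noteq> 0"
    and "\<And>i. i \<in> {1..n} \<Longrightarrow> a i \<ge> -2"
  shows
    "(\<lambda>k. series_of_z (\<Prod>i\<in>{1..n}. (1 - fls_const (t i) * fls_X) powi a i) k
        - series_of_z_inv (\<Prod>i\<in>{1..n}. (1 - fls_const (inverse (t i)) * fls_X) powi a i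
                                  * (- fls_const (t i) * fls_X_inv) powi a i) k)
     = (\<lambda>k. (\<Sum>i\<in>level_set n a (-1).
                (\<Prod>j\<in>{1..n} - {i}. (1 - t j * inverse (t i)) powi a j) * rescale delta (t i) k)
          + (\<Sum>i\<in>level_set n a (-2).
                (\<Prod>j\<in>{1..n} - {i}. (1 - t j * inverse (t i)) powi a j)
                * (rescale (D delta) (t i) k
                   + (1 + (\<Sum>j\<in>{1..n} - {i}. of_int (a j) * inverse (t i * inverse (t j) - 1)))
                     * rescale delta (t i) k)))"
proof -
  let ?I = "{1..n}"
  have G: "(1 - fls_const (inverse (t i)) * fls_X) powi a i * (- fls_const (t i) * fls_X_inv) powi a i
      = (1 - fls_const (t i) * fls_X_inv) powi a i" if "i \<in> ?I" for i
    using one_minus_const_X_inv_factor[OF assms(2)[OF that]]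
    by (simp only: flip: power_int_mult_distrib)
  have prod_G: "(\<Prod>i\<in>?I. (1 - fls_const (inverse (t i)) * fls_X) powi a i
        * (- fls_const (t i) * fls_X_inv) powi a i)
      = (\<Prod>i\<in>?I. (1 - fls_const (t i) * fls_X_inv) powi a i)"
    by (rule prod.cong[OF refl G])
  have "expansion_gap ?I t a k = (\<Sum>i\<in>?I. pole_term ?I t a i k)" for k
    using fun_cong[OF gap_error_eq_0[of ?I t a], of k] assms by (simp add: gap_error_def)
  moreover have "(\<Sum>i\<in>?I. pole_term ?I t a i k)
      = (\<Sum>i\<in>level_set n a (-1). pole_coeff ?I t a i * rescale delta (t i) k)
      + (\<Sum>i\<in>level_set n a (-2). pole_coeff ?I t a i
           * (rescale (D delta) (t i) k + pole_shift ?I t a i * rescale delta (t i) k))" for k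
  proof -
    \<comment> \<open>Writing the case distinction as a sum of two indicator terms lets each become
      a sum over its level set.\<close>
    have "pole_term ?I t a i k
        = (if a i = -1 then pole_coeff ?I t a i * rescale delta (t i) k else 0)
        + (if a i = -2 then pole_coeff ?I t a i
             * (rescale (D delta) (t i) k + pole_shift ?I t a i * rescale delta (t i) k) else 0)" for i
      by (simp add: pole_term_def rescale_def delta_def D_def algebra_simps)
    then show ?thesis
      by (simp only: sum.distrib level_set_def sum.inter_filter finite_atLeastAtMost)
  qed
  ultimately show ?thesis
    unfolding prod_G by (simp only: expansion_gap_def pole_coeff_def pole_shift_def)
qed

end
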